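(* Let $D$ be an integral domain of characteristic zero with field of fractions $Q(D)$, and let $A,B,w\in A_1(D)$ with $[A,B]\in D^*$ and $[A,w]=0$. Then $w\in Q(D)[A]$ (viewed inside $A_1(Q(D))\supseteq A_1(D)$).
   Context: For a commutative ring $R$, the first Weyl algebra $A_1(R)$ is the unital associative $R$-algebra generated by $X,Y$ subject to $[Y,X]=YX-XY=1$; it is a free $R$-module with basis $\{X^iY^j\}_{i,j\ge0}$, and $A_1(D)\subseteq A_1(Q(D))$. $[P,Q]=PQ-QP$. $D^*$ is the group of units of $D$. $Q(D)[A]$ denotes the $Q(D)$-subalgebra of $A_1(Q(D))$ generated by $A$. *)

theory Defs
  imports Main "HOL-Library.Poly_Mapping" "HOL-Computational_Algebra.Fraction_Field"
begin

text \<open>Elements of the first Weyl algebra A_1(R) are represented by their (finitely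
  supported) coefficient families with respect to the R-basis X^i Y^j, i.e. the
  element sum c_(i,j) X^i Y^j is the finitely supported map (i,j) |-> c_(i,j).\<close>

type_synonym 'a weyl = "(nat \<times> nat) \<Rightarrow>\<^sub>0 'a"

text \<open>Multiplication, determined by [Y,X] = YX - XY = 1, which gives
  Y^j X^k = sum_t C(j,t) C(k,t) t! X^(k-t) Y^(j-t).\<close>

definition weyl_mult :: "'a::comm_ring_1 weyl \<Rightarrow> 'a weyl \<Rightarrow> 'a weyl" where
  "weyl_mult P Q =
     (\<Sum>(i,j)\<in>Poly_Mapping.keys P. \<Sum>(k,l)\<in>Poly_Mapping.keys Q. \<Sum>t\<in>{..min j k}.
        Poly_Mapping.single (i + k - t, j + l - t)
          (Poly_Mapping.lookup P (i,j) * Poly_Mapping.lookup Q (k,l) * of_nat ((j choose t) * (k choose t) * fact t)))"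

definition weyl_const :: "'a::zero \<Rightarrow> 'a weyl" where
  "weyl_const c = Poly_Mapping.single (0,0) c"

definition weyl_X :: "'a::{zero,one} weyl" where
  "weyl_X = Poly_Mapping.single (1,0) 1"

definition weyl_Y :: "'a::{zero,one} weyl" where
  "weyl_Y = Poly_Mapping.single (0,1) 1"

definition weyl_comm :: "'a::comm_ring_1 weyl \<Rightarrow> 'a weyl \<Rightarrow> 'a weyl" where
  "weyl_comm P Q = weyl_mult P Q - weyl_mult Q P"

definition weyl_to_frac :: "'a::idom weyl \<Rightarrow> 'a fract weyl" where
  "weyl_to_frac P = Poly_Mapping.map (\<lambda>x. Fract x 1) P"

inductive_set weyl_gen_subalg :: "'a::field weyl \<Rightarrow> 'a weyl set" for A where
  const: "weyl_const c \<in> weyl_gen_subalg A"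
| gen: "A \<in> weyl_gen_subalg A"
| add: "P \<in> weyl_gen_subalg A \<Longrightarrow> Q \<in> weyl_gen_subalg A \<Longrightarrow> P + Q \<in> weyl_gen_subalg A"
| mult: "P \<in> weyl_gen_subalg A \<Longrightarrow> Q \<in> weyl_gen_subalg A \<Longrightarrow> weyl_mult P Q \<in> weyl_gen_subalg A"

end

theory Submission
  imports Defs "HOL-Computational_Algebra.Polynomial"
begin

text \<open>Over the field \<open>K = Q(D)\<close>, let \<open>A_1(K)\<close> act faithfully on \<open>K[X]\<close> by differential operators
  \<open>\<Sum> a_j(X) \<partial>^j\<close>, and let \<open>f\<close> of order \<open>m\<close> with leading coefficient \<open>b\<close> commute with \<open>A\<close>, which has
  order \<open>r > 0\<close> and leading coefficient \<open>a\<close>. The leading coefficient of \<open>[A, f]\<close> gives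
  \<open>r a b' = m b a'\<close>, so \<open>b^r = l a^m\<close> for a scalar \<open>l\<close>, and \<open>f^r - l A^m\<close> has order less than \<open>r m\<close>.

  The derivation \<open>\<delta> = [\<cdot>, B]\<close> preserves the centralizer \<open>C\<close> of \<open>A\<close>, and \<open>ord (\<delta> f) - ord f\<close> is bounded
  by \<open>ord B\<close>. If this difference exceeded \<open>-r\<close> for some \<open>f \<in> C\<close>, then \<open>f^r - l A^m\<close> would give a larger
  one, contradicting boundedness; hence \<open>\<delta>\<close> lowers the order by at least \<open>r\<close> on \<open>C\<close>. The same comparison
  shows that \<open>\<delta>\<close> has kernel \<open>K\<close> on \<open>C\<close>. As \<open>\<delta> A\<close> is a nonzero constant, every element of \<open>K[A]\<close> has
  a \<open>\<delta>\<close>-antiderivative in \<open>K[A]\<close>, and induction on the order yields \<open>C = K[A]\<close>.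

  If \<open>A\<close> has order \<open>0\<close>, then \<open>A\<close> is a polynomial in \<open>X\<close>, which must be linear, and \<open>C = K[X] = K[A]\<close>.\<close>

section \<open>Polynomials with equal logarithmic derivatives\<close>

lemma degree_eq_of_log_deriv_eq:
  fixes P Q :: "'k::field_char_0 poly"
  assumes "pderiv P * Q = P * pderiv Q" "P \<noteq> 0" "Q \<noteq> 0"
  shows "degree P = degree Q"
proof (cases "degree P = 0 \<or> degree Q = 0")
  case True
  then have "pderiv P = 0 \<or> pderiv Q = 0"
    by (simp add: pderiv_eq_0_iff)
  with assms have "pderiv P = 0 \<and> pderiv Q = 0"
    by auto
  then show ?thesis
    by (simp add: pderiv_eq_0_iff)
next
  case False
  then obtain m n where mn: "degree P = Suc m" "degree Q = Suc n"
    by (auto simp: gr0_conv_Suc)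
  have "lead_coeff (pderiv P * Q) = lead_coeff (P * pderiv Q)"
    using assms by simp
  then have "of_nat (Suc m) * lead_coeff P * lead_coeff Q = lead_coeff P * (of_nat (Suc n) * lead_coeff Q)"
    unfolding lead_coeff_mult by (simp add: degree_pderiv coeff_pderiv mn)
  then have "(of_nat (Suc m) :: 'k) = of_nat (Suc n)"
    using assms by (simp del: of_nat_Suc)
  then show ?thesis
    using mn by (simp only: of_nat_eq_iff)
qed

text \<open>The equation is linear in \<open>P\<close>. Subtracting the multiple of \<open>Q\<close>
  that cancels the leading term leaves a solution \<open>R\<close> which, if nonzero, would again
  need the degree of \<open>Q\<close>.\<close>

lemma proportional_of_log_deriv_eq:
  fixes P Q :: "'k::field_char_0 poly"
  assumes eq: "pderiv P * Q = P * pderiv Q" and nz: "P \<noteq> 0" "Q \<noteq> 0"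
  shows "P = smult (lead_coeff P / lead_coeff Q) Q"
proof (rule ccontr)
  define l where "l = lead_coeff P / lead_coeff Q"
  define R where "R = P - smult l Q"
  assume "\<not> ?thesis"
  then have R0: "R \<noteq> 0"
    by (simp add: R_def l_def)
  have "pderiv R * Q = R * pderiv Q"
    unfolding R_def pderiv_diff pderiv_smult using eq by (simp add: algebra_simps)
  then have dR: "degree R = degree Q"
    using degree_eq_of_log_deriv_eq R0 nz by blast
  have "coeff R (degree Q) = 0"
    using degree_eq_of_log_deriv_eq[OF eq nz] nz by (simp add: R_def l_def)
  then show False
    using dR R0 by (metis leading_coeff_0_iff)
qed

text \<open>The hypothesis says that \<open>b ^ r\<close> and \<open>a ^ m\<close> have the same
  logarithmic derivative; powers avoid taking roots.\<close>

lemma power_proportional: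
  fixes a b :: "'k::field_char_0 poly"
  assumes eq: "of_nat r * a * pderiv b = of_nat m * b * pderiv a"
    and nz: "a \<noteq> 0" "b \<noteq> 0" and "0 < r"
  obtains l where "l \<noteq> 0" "b ^ r = smult l (a ^ m)"
proof -
  obtain r' where r: "r = Suc r'"
    using \<open>0 < r\<close> by (auto simp: gr0_conv_Suc)
  have "pderiv (b ^ r) * a ^ m = b ^ r * pderiv (a ^ m)"
  proof (cases m)
    case 0
    then show ?thesis using eq nz \<open>0 < r\<close> by (simp add: pderiv_power)
  next
    case (Suc m')
    have "pderiv (b ^ r) * a ^ m = b ^ r' * a ^ m' * (of_nat r * a * pderiv b)"
      unfolding r pderiv_power_Suc Suc by (simp add: of_nat_poly ac_simps)
    also have "\<dots> = b ^ r' * a ^ m' * (of_nat m * b * pderiv a)"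
      by (simp only: eq)
    also have "\<dots> = b ^ r * pderiv (a ^ m)"
      unfolding r pderiv_power_Suc Suc by (simp add: of_nat_poly ac_simps)
    finally show ?thesis .
  qed
  from proportional_of_log_deriv_eq[OF this] nz that show thesis
    by (metis divide_eq_0_iff leading_coeff_0_iff power_not_zero)
qed

section \<open>Order and symbol of differential operators\<close>

text \<open>\<open>M\<close> stands for multiplication by a polynomial and \<open>D\<close> for the
  derivative. Injectivity of \<open>M\<close> and the commutation rule make the powers of
  \<open>D\<close> independent over the polynomials (\<open>ops_coeffs_0\<close>).\<close>

locale weyl_operators =
  fixes M :: "'k::field_char_0 poly \<Rightarrow> 'r::ring_1" and D :: 'r
  assumes M_add: "M (p + q) = M p + M q"
    and M_mult: "M (p * q) = M p * M q"
    and M_one: "M 1 = 1"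
    and M_eq_0: "M p = 0 \<Longrightarrow> p = 0"
    and D_M: "D * M p = M p * D + M (pderiv p)"
begin

lemma M_0 [simp]: "M 0 = 0"
  using M_add[of 0 0] by simp

lemma M_minus: "M (- p) = - M p"
  using M_add[of p "- p"] by (simp add: eq_neg_iff_add_eq_0 add.commute)

lemma M_diff: "M (p - q) = M p - M q"
  using M_add[of p "- q"] by (simp add: M_minus)

lemma M_sum: "M (sum f I) = (\<Sum>i\<in>I. M (f i))"
  by (induction I rule: infinite_finite_induct) (auto simp: M_add)

text \<open>The operators of order strictly less than \<open>n\<close>.\<close>

definition ops :: "nat \<Rightarrow> 'r set" where
  "ops n = {L. \<exists>c. L = (\<Sum>j<n. M (c j) * D ^ j)}"

text \<open>Order at most \<open>n\<close> with \<open>a\<close> as the coefficient of \<open>D ^ n\<close>; \<open>a = 0\<close> is allowed.\<close>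

definition has_symbol :: "nat \<Rightarrow> 'k poly \<Rightarrow> 'r \<Rightarrow> bool" where
  "has_symbol n a L \<longleftrightarrow> L - M a * D ^ n \<in> ops n"

lemma opsI: "(\<Sum>j<n. M (c j) * D ^ j) \<in> ops n"
  unfolding ops_def by blast

lemma ops_0 [simp]: "ops 0 = {0}"
  by (auto simp: ops_def)

lemma zero_in_ops [simp]: "0 \<in> ops n"
  unfolding ops_def by (auto intro!: exI[of _ "\<lambda>_. 0"])

lemma ops_add: "L \<in> ops n \<Longrightarrow> N \<in> ops n \<Longrightarrow> L + N \<in> ops n"
proof -
  assume "L \<in> ops n" "N \<in> ops n"
  then obtain c d where "L = (\<Sum>j<n. M (c j) * D ^ j)" "N = (\<Sum>j<n. M (d j) * D ^ j)"
    unfolding ops_def by blast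
  then have "L + N = (\<Sum>j<n. M (c j + d j) * D ^ j)"
    by (simp add: M_add sum.distrib ring_distribs)
  then show ?thesis by (simp only: opsI)
qed

lemma ops_M: "L \<in> ops n \<Longrightarrow> M p * L \<in> ops n"
proof -
  assume "L \<in> ops n"
  then obtain c where "L = (\<Sum>j<n. M (c j) * D ^ j)"
    unfolding ops_def by blast
  then have "M p * L = (\<Sum>j<n. M (p * c j) * D ^ j)"
    by (simp add: M_mult sum_distrib_left mult.assoc)
  then show ?thesis by (simp only: opsI)
qed

lemma ops_minus: "L \<in> ops n \<Longrightarrow> - L \<in> ops n"
  using ops_M[of L n "- 1"] by (simp add: M_minus M_one)

lemma ops_diff: "L \<in> ops n \<Longrightarrow> N \<in> ops n \<Longrightarrow> L - N \<in> ops n"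
  using ops_add[of L n "- N"] ops_minus[of N n] by simp

lemma ops_sum: "(\<And>i. i \<in> I \<Longrightarrow> f i \<in> ops n) \<Longrightarrow> sum f I \<in> ops n"
  by (induction I rule: infinite_finite_induct) (auto intro: ops_add)

lemma ops_term: "k < n \<Longrightarrow> M p * D ^ k \<in> ops n"
proof -
  assume "k < n"
  then have "M p * D ^ k = (\<Sum>j<n. M (if j = k then p else 0) * D ^ j)"
    by (simp add: if_distrib[of M] if_distrib[of "\<lambda>x. x * _"] cong: if_cong)
  then show ?thesis by (simp only: opsI)
qed

lemma opsE:
  assumes "L \<in> ops n"
  obtains c where "L = (\<Sum>j<n. M (c j) * D ^ j)"
  using assms unfolding ops_def by blast

lemma ops_mono: "L \<in> ops n \<Longrightarrow> n \<le> m \<Longrightarrow> L \<in> ops m"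
  by (elim opsE) (auto intro!: ops_sum ops_term)

lemma ops_mult_D: "L \<in> ops n \<Longrightarrow> L * D ^ k \<in> ops (n + k)"
proof (elim opsE, clarify)
  fix c
  have "M (c j) * D ^ j * D ^ k \<in> ops (n + k)" if "j < n" for j
    using ops_term[of "j + k" "n + k" "c j"] that by (simp add: mult.assoc power_add)
  then show "(\<Sum>j<n. M (c j) * D ^ j) * D ^ k \<in> ops (n + k)"
    by (auto simp: sum_distrib_right intro!: ops_sum)
qed

lemma D_ops: "L \<in> ops n \<Longrightarrow> D * L \<in> ops (Suc n)"
proof (elim opsE, clarify)
  fix c
  have "D * (M (c j) * D ^ j) \<in> ops (Suc n)" if "j < n" for j
  proof -
    have "D * (M (c j) * D ^ j) = M (c j) * D ^ Suc j + M (pderiv (c j)) * D ^ j"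
      by (simp add: mult.assoc[symmetric] D_M ring_distribs)
    with that show ?thesis by (simp only: ops_add ops_term Suc_less_eq less_SucI)
  qed
  then show "D * (\<Sum>j<n. M (c j) * D ^ j) \<in> ops (Suc n)"
    by (auto simp: sum_distrib_left intro!: ops_sum)
qed

text \<open>The first two terms of the Leibniz rule. The second is kept because the first cancels in
  commutators.\<close>

lemma D_power_M_Suc:
  "D ^ Suc j * M p - M p * D ^ Suc j - M (of_nat (Suc j) * pderiv p) * D ^ j \<in> ops j"
proof (induction j)
  case 0
  then show ?case by (simp add: D_M)
next
  case (Suc j)
  define E where "E = D ^ Suc j * M p - M p * D ^ Suc j - M (of_nat (Suc j) * pderiv p) * D ^ j"
  define q where "q = of_nat (Suc j) * pderiv p"
  have eq: "D ^ Suc j * M p = E + M p * D ^ Suc j + M q * D ^ j"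
    by (simp add: E_def q_def)
  have q: "of_nat (Suc (Suc j)) * pderiv p = q + pderiv p"
    by (simp add: q_def algebra_simps)
  have "D ^ Suc (Suc j) * M p = D * (D ^ Suc j * M p)"
    by (simp add: mult.assoc)
  also have "\<dots> = D * E + (D * M p) * D ^ Suc j + (D * M q) * D ^ j"
    unfolding eq by (simp add: ring_distribs mult.assoc)
  also have "\<dots> = M p * D ^ Suc (Suc j) + (M q + M (pderiv p)) * D ^ Suc j + (M (pderiv q) * D ^ j + D * E)"
    unfolding D_M by (simp add: ring_distribs mult.assoc)
  finally have "D ^ Suc (Suc j) * M p - M p * D ^ Suc (Suc j) - M (of_nat (Suc (Suc j)) * pderiv p) * D ^ Suc j
     = M (pderiv q) * D ^ j + D * E"
    unfolding q M_add by simp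
  moreover have "M (pderiv q) * D ^ j + D * E \<in> ops (Suc j)"
    using Suc.IH[folded E_def] by (intro ops_add ops_term D_ops) auto
  ultimately show ?case by simp
qed

lemma D_power_M:
  "D ^ n * M p - M p * D ^ n - M (of_nat n * pderiv p) * D ^ (n - 1) \<in> ops (n - 1)"
  using D_power_M_Suc[of "n - 1" p] by (cases n) auto

lemma term_mult_term:
  "(M a * D ^ n) * (M b * D ^ m) - M (a * b) * D ^ (n + m)
     - M (of_nat n * a * pderiv b) * D ^ (n + m - 1) \<in> ops (n + m - 1)"
proof (cases n)
  case 0
  then show ?thesis by (simp add: M_mult mult.assoc)
next
  case (Suc k)
  define E where "E = D ^ n * M b - M b * D ^ n - M (of_nat n * pderiv b) * D ^ (n - 1)"
  have eq: "D ^ n * M b = E + M b * D ^ n + M (of_nat n * pderiv b) * D ^ (n - 1)"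
    by (simp add: E_def)
  have "(M a * D ^ n) * (M b * D ^ m) = M a * (D ^ n * M b) * D ^ m"
    by (simp add: mult.assoc)
  also have "\<dots> = M a * (E * D ^ m) + M (a * b) * D ^ (n + m)
     + M (a * (of_nat n * pderiv b)) * D ^ (n - 1 + m)"
    unfolding eq by (simp add: ring_distribs mult.assoc M_mult power_add)
  finally have "(M a * D ^ n) * (M b * D ^ m) - M (a * b) * D ^ (n + m)
     - M (of_nat n * a * pderiv b) * D ^ (n + m - 1) = M a * (E * D ^ m)"
    using Suc by (simp add: ac_simps)
  moreover have "M a * (E * D ^ m) \<in> ops (n - 1 + m)"
    using D_power_M[of n b, folded E_def] by (intro ops_M ops_mult_D)
  ultimately show ?thesis using Suc by simp
qed

lemma term_mult_term_symbol:
  "(M a * D ^ n) * (M b * D ^ m) - M (a * b) * D ^ (n + m) \<in> ops (n + m)"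
proof (cases "n + m")
  case 0
  then show ?thesis by (simp add: M_mult)
next
  case (Suc k)
  have "M (of_nat n * a * pderiv b) * D ^ (n + m - 1) \<in> ops (n + m)"
    using Suc by (intro ops_term) auto
  from ops_add[OF ops_mono[OF term_mult_term[of a n b m]] this] show ?thesis
    by simp
qed

lemma term_mult_term_ops: "(M a * D ^ n) * (M b * D ^ m) \<in> ops (Suc (n + m))"
  using ops_add[OF ops_mono[OF term_mult_term_symbol[of a n b m], of "Suc (n + m)"]
      ops_term[of "n + m" "Suc (n + m)" "a * b"]]
  by simp

lemma term_comm_term:
  "(M a * D ^ n) * (M b * D ^ m) - (M b * D ^ m) * (M a * D ^ n)
     - M (of_nat n * a * pderiv b - of_nat m * b * pderiv a) * D ^ (n + m - 1) \<in> ops (n + m - 1)"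
  using ops_diff[OF term_mult_term[of a n b m] term_mult_term[of b m a n, unfolded add.commute[of m n]]]
  by (simp add: algebra_simps M_diff)

lemma term_comm_term_ops:
  "(M a * D ^ n) * (M b * D ^ m) - (M b * D ^ m) * (M a * D ^ n) \<in> ops (n + m)"
proof (cases "n + m")
  case 0
  then show ?thesis by (simp add: M_mult[symmetric] mult.commute)
next
  case (Suc k)
  have "M (of_nat n * a * pderiv b - of_nat m * b * pderiv a) * D ^ (n + m - 1) \<in> ops (n + m)"
    using Suc by (intro ops_term) auto
  from ops_add[OF ops_mono[OF term_comm_term[of a n b m]] this] show ?thesis
    by simp
qed

lemma sum_mult_sum:
  fixes f g :: "nat \<Rightarrow> 'r"
  shows "sum f I * sum g J = (\<Sum>i\<in>I. \<Sum>j\<in>J. f i * g j)"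
  by (simp add: sum_distrib_left sum_distrib_right) (rule sum.swap)

lemma ops_mult: "L \<in> ops (Suc n) \<Longrightarrow> N \<in> ops m \<Longrightarrow> L * N \<in> ops (n + m)"
  by (elim opsE) (auto simp del: sum.lessThan_Suc simp: sum_mult_sum
      intro!: ops_sum intro: ops_mono[OF term_mult_term_ops])

lemma ops_mult': "L \<in> ops n \<Longrightarrow> N \<in> ops (Suc m) \<Longrightarrow> L * N \<in> ops (n + m)"
  by (elim opsE) (auto simp del: sum.lessThan_Suc simp: sum_mult_sum
      intro!: ops_sum intro: ops_mono[OF term_mult_term_ops])

lemma ops_comm:
  assumes "L \<in> ops (Suc n)" "N \<in> ops m"
  shows "L * N - N * L \<in> ops (n + m - 1)"
proof -
  from assms obtain c d where L: "L = (\<Sum>i<Suc n. M (c i) * D ^ i)"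
    and N: "N = (\<Sum>j<m. M (d j) * D ^ j)"
    by (elim opsE)
  have "L * N - N * L = (\<Sum>i<Suc n. \<Sum>j<m. (M (c i) * D ^ i) * (M (d j) * D ^ j)
     - (M (d j) * D ^ j) * (M (c i) * D ^ i))"
    unfolding L N sum_mult_sum sum_subtractf
    by (subst (2) sum.swap) (rule refl)
  also have "\<dots> \<in> ops (n + m - 1)"
  proof (intro ops_sum)
    fix i j assume "i \<in> {..<Suc n}" "j \<in> {..<m}"
    then show "(M (c i) * D ^ i) * (M (d j) * D ^ j) - (M (d j) * D ^ j) * (M (c i) * D ^ i) \<in> ops (n + m - 1)"
      by (intro ops_mono[OF term_comm_term_ops]) auto
  qed
  finally show ?thesis .
qed

lemma has_symbol_split:
  assumes "has_symbol n a L"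
  obtains E where "E \<in> ops n" "L = M a * D ^ n + E"
  using assms unfolding has_symbol_def by (metis add.commute diff_add_cancel)

lemma has_symbol_ops: "has_symbol n a L \<Longrightarrow> L \<in> ops (Suc n)"
  by (elim has_symbol_split) (auto intro!: ops_add ops_term intro: ops_mono)

lemma has_symbol_add: "has_symbol n a L \<Longrightarrow> has_symbol n b N \<Longrightarrow> has_symbol n (a + b) (L + N)"
  unfolding has_symbol_def using ops_add[of "L - M a * D ^ n" n "N - M b * D ^ n"]
  by (simp add: M_add algebra_simps)

lemma has_symbol_minus: "has_symbol n a L \<Longrightarrow> has_symbol n (- a) (- L)"
  unfolding has_symbol_def using ops_minus[of "L - M a * D ^ n" n]
  by (simp add: M_minus)

lemma has_symbol_diff: "has_symbol n a L \<Longrightarrow> has_symbol n b N \<Longrightarrow> has_symbol n (a - b) (L - N)"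
  using has_symbol_add[OF _ has_symbol_minus] by fastforce

lemma has_symbol_zero_iff: "has_symbol n 0 L \<longleftrightarrow> L \<in> ops n"
  by (simp add: has_symbol_def)

lemma has_symbol_M: "has_symbol 0 p (M p)"
  by (simp add: has_symbol_def)

lemma has_symbol_mult:
  assumes "has_symbol n a L" "has_symbol m b N"
  shows "has_symbol (n + m) (a * b) (L * N)"
proof -
  obtain E F where E: "E \<in> ops n" "L = M a * D ^ n + E" and F: "F \<in> ops m" "N = M b * D ^ m + F"
    using assms by (elim has_symbol_split)
  have "L * N - M (a * b) * D ^ (n + m) =
      ((M a * D ^ n) * (M b * D ^ m) - M (a * b) * D ^ (n + m)) + E * N + (M a * D ^ n) * F"
    unfolding E(2) F(2) by (simp add: algebra_simps)
  also have "\<dots> \<in> ops (n + m)"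
    using E(1) F(1) assms
    by (intro ops_add term_mult_term_symbol ops_mult ops_mult' ops_term) (auto intro: has_symbol_ops)
  finally show ?thesis unfolding has_symbol_def .
qed

text \<open>The products of the leading coefficients cancel, and the second Leibniz terms leave the
  Poisson bracket of the symbols. For \<open>n = m = 0\<close> this bracket is 0, so the truncated
  order does no harm.\<close>

lemma has_symbol_comm:
  assumes "has_symbol n a L" "has_symbol m b N"
  shows "has_symbol (n + m - 1) (of_nat n * a * pderiv b - of_nat m * b * pderiv a) (L * N - N * L)"
proof -
  obtain E F where E: "E \<in> ops n" "L = M a * D ^ n + E" and F: "F \<in> ops m" "N = M b * D ^ m + F"
    using assms by (elim has_symbol_split)
  have "L * N - N * L - M (of_nat n * a * pderiv b - of_nat m * b * pderiv a) * D ^ (n + m - 1) =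
      ((M a * D ^ n) * (M b * D ^ m) - (M b * D ^ m) * (M a * D ^ n)
        - M (of_nat n * a * pderiv b - of_nat m * b * pderiv a) * D ^ (n + m - 1))
      - (N * E - E * N) + ((M a * D ^ n) * F - F * (M a * D ^ n))"
    unfolding E(2) F(2) by (simp add: algebra_simps)
  also have "\<dots> \<in> ops (n + m - 1)"
  proof (rule ops_add[OF ops_diff[OF term_comm_term]])
    show "(M a * D ^ n) * F - F * (M a * D ^ n) \<in> ops (n + m - 1)"
      using F(1) by (intro ops_comm ops_term) auto
    show "N * E - E * N \<in> ops (n + m - 1)"
      using ops_comm[OF has_symbol_ops[OF assms(2)] E(1)] by (simp add: add.commute)
  qed
  finally show ?thesis unfolding has_symbol_def .
qed

text \<open>The commutator with the variable differentiates formally with respect to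
  \<open>D\<close>: it turns symbol \<open>a\<close> in order \<open>n\<close> into
  \<open>n a\<close> one order lower. In order 0 a multiplication operator is left, and
  \<open>M\<close> is injective.\<close>

lemma has_symbol_0D: "has_symbol n a 0 \<Longrightarrow> a = 0"
proof (induction n arbitrary: a)
  case 0
  then have "M a = 0" by (simp add: has_symbol_def)
  then show ?case by (rule M_eq_0)
next
  case (Suc n)
  from has_symbol_comm[OF Suc.prems has_symbol_M[of "[:0, 1:]"]]
  have "has_symbol n (of_nat (Suc n) * a) 0"
    by (simp add: pderiv_pCons)
  then show ?case
    using Suc.IH by (metis mult_eq_0_iff of_nat_eq_0_iff nat.distinct(1))
qed

lemma has_symbol_unique: "has_symbol n a L \<Longrightarrow> has_symbol n b L \<Longrightarrow> a = b"
  using has_symbol_0D[of n "a - b"] has_symbol_diff[of n a L b L] by simp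

lemma has_symbol_in_ops:
  assumes "has_symbol n a L" "a \<noteq> 0" "L \<in> ops m"
  shows "n < m"
proof (rule ccontr)
  assume "\<not> n < m"
  with assms(3) have "has_symbol n 0 L"
    unfolding has_symbol_zero_iff by (auto intro: ops_mono)
  with assms show False using has_symbol_unique by blast
qed

lemma ops_coeffs_0:
  assumes "(\<Sum>j<n. M (c j) * D ^ j) = 0" "j < n"
  shows "c j = 0"
  using assms
proof (induction n)
  case (Suc n)
  have "has_symbol n (- c n) (\<Sum>j<n. M (c j) * D ^ j)"
    using Suc.prems(1) by (simp add: has_symbol_def M_minus)
  \<comment> \<open>The lower terms equal minus the top one, which gives them symbol
    \<open>- c n\<close>; lying in \<open>ops n\<close>, they also have symbol 0.\<close>
  moreover have "has_symbol n 0 (\<Sum>j<n. M (c j) * D ^ j)"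
    unfolding has_symbol_zero_iff ops_def by blast
  ultimately have "c n = 0"
    using has_symbol_unique by fastforce
  then show ?case using Suc by (cases "j = n") auto
qed simp

lemma obtain_symbol:
  assumes "L \<in> ops n" "L \<noteq> 0"
  obtains m b where "m < n" "b \<noteq> 0" "has_symbol m b L"
proof -
  have "\<exists>m b. m < n \<and> b \<noteq> 0 \<and> has_symbol m b L"
    using assms(1)
  proof (induction n)
    case 0
    then show ?case using assms by simp
  next
    case (Suc n)
    then obtain c where c: "L = (\<Sum>j<Suc n. M (c j) * D ^ j)" by (elim opsE)
    show ?case
    proof (cases "c n = 0")
      case True
      then have "L \<in> ops n" unfolding ops_def c by auto
      then show ?thesis using Suc.IH less_SucI by blast
    next
      case False
      have "has_symbol n (c n) L" unfolding has_symbol_def ops_def c by auto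
      then show ?thesis using False by blast
    qed
  qed
  then show thesis using that by blast
qed

lemma has_symbol_power: "has_symbol m b L \<Longrightarrow> has_symbol (m * k) (b ^ k) (L ^ k)"
proof (induction k)
  case 0
  then show ?case using has_symbol_M[of 1] by (simp add: M_one)
next
  case (Suc k)
  then show ?case using has_symbol_mult[of m b L "m * k" "b ^ k" "L ^ k"] by simp
qed

text \<open>Constants have derivative 0. The claim is confined to \<open>ops n\<close> because
  \<open>'r\<close> may contain elements that are not linear over the scalars.\<close>

lemma const_comm: "L \<in> ops n \<Longrightarrow> M [:c:] * L = L * M [:c:]"
proof (elim opsE, clarify)
  fix d
  have DM: "D * M [:c:] = M [:c:] * D" by (simp add: D_M)
  have "M [:c:] * (M (d j) * D ^ j) = M (d j) * D ^ j * M [:c:]" for j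
    by (metis DM M_mult mult.assoc mult.commute power_commuting_commutes)
  then show "M [:c:] * (\<Sum>j<n. M (d j) * D ^ j) = (\<Sum>j<n. M (d j) * D ^ j) * M [:c:]"
    by (simp add: sum_distrib_left sum_distrib_right)
qed

lemma const_power_commute: "L \<in> ops n \<Longrightarrow> L * (M [:c:] * L ^ k) = M [:c:] * L ^ k * L"
proof -
  assume "L \<in> ops n"
  then have "L * (M [:c:] * L ^ k) = M [:c:] * (L * L ^ k)"
    by (simp only: const_comm mult.assoc[symmetric])
  then show ?thesis by (simp only: power_commutes mult.assoc)
qed

lemma has_symbol_const_mult: "has_symbol m b L \<Longrightarrow> has_symbol m (smult c b) (M [:c:] * L)"
  using has_symbol_mult[OF has_symbol_M, of m b L "[:c:]"] by simp

text \<open>The product rule for the derivation \<open>[\<cdot>, B]\<close>, on the level of symbols only: \<open>f\<close>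
  need not commute with \<open>[f, B]\<close>.\<close>

lemma has_symbol_power_comm:
  assumes f: "has_symbol m b f" and df: "has_symbol s d (f * B - B * f)"
  shows "has_symbol (m * k + s) (of_nat (Suc k) * b ^ k * d) (f ^ Suc k * B - B * f ^ Suc k)"
proof (induction k)
  case 0
  then show ?case using df by simp
next
  case (Suc k)
  have "f ^ Suc (Suc k) * B - B * f ^ Suc (Suc k)
      = f * (f ^ Suc k * B - B * f ^ Suc k) + (f * B - B * f) * f ^ Suc k"
    by (simp add: algebra_simps)
  moreover have "has_symbol (m * Suc k + s) (of_nat (Suc (Suc k)) * b ^ Suc k * d) \<dots>"
    using has_symbol_add[OF has_symbol_mult[OF f Suc.IH, folded add.assoc mult_Suc_right]
        has_symbol_mult[OF df has_symbol_power[OF f, of "Suc k"], unfolded add.commute[of s]]]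
    by (simp add: algebra_simps)
  ultimately show ?case by (simp only:)
qed

section \<open>Centralizers\<close>

text \<open>The algebra K[A], built up one monomial at a time so that antiderivatives can be formed
  term by term.\<close>

inductive_set polys :: "'r \<Rightarrow> 'r set" for A where
  zero: "0 \<in> polys A"
| add: "L \<in> polys A \<Longrightarrow> L + M [:c:] * A ^ i \<in> polys A"

lemma polys_mult_gen:
  assumes A: "A \<in> ops n" and "L \<in> polys A"
  shows "A * L \<in> polys A"
  using assms(2)
proof induction
  case zero
  then show ?case by (simp add: polys.zero)
next
  case (add L d i)
  have "A * (L + M [:d:] * A ^ i) = A * L + M [:d:] * A ^ Suc i"
    using const_comm[OF A, of d] by (simp add: ring_distribs mult.assoc[symmetric])
  then show ?case using polys.add[OF add.IH] by (simp only:)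
qed

lemma M_pcompose_in_polys: "M (pcompose q p) \<in> polys (M p)"
proof (induction q)
  case 0
  then show ?case by (simp add: polys.zero)
next
  case (pCons d q)
  have "M p * M (pcompose q p) \<in> polys (M p)"
    using polys_mult_gen[OF has_symbol_ops[OF has_symbol_M]] pCons.IH by blast
  from polys.add[OF this, of d 0] show ?case
    by (simp add: pcompose_pCons M_add M_mult add.commute)
qed

text \<open>Jacobi identity: [A, [f, B]] = [[A, f], B] + [f, [A, B]], and both terms vanish.\<close>

lemma comm_in_centralizer:
  assumes AB: "A * B - B * A = M [:c:]" and f: "f \<in> ops n" "A * f = f * A"
  shows "A * (f * B - B * f) = (f * B - B * f) * A"
proof -
  have AB': "A * B = B * A + M [:c:]"
    using AB by (simp add: algebra_simps)
  have "A * (f * B - B * f) = (A * f) * B - (A * B) * f"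
    by (simp add: algebra_simps)
  also have "\<dots> = f * (A * B) - (A * B) * f"
    unfolding f(2) by (simp add: algebra_simps)
  also have "\<dots> = f * B * A - B * (A * f) + (f * M [:c:] - M [:c:] * f)"
    unfolding AB' by (simp add: algebra_simps)
  also have "\<dots> = (f * B - B * f) * A"
    unfolding f(2) const_comm[OF f(1)] by (simp add: algebra_simps)
  finally show ?thesis .
qed

lemma commuting_power:
  fixes x y :: 'r
  shows "x * y = y * x \<Longrightarrow> x * y ^ n = y ^ n * x"
  by (rule power_commuting_commutes[symmetric]) simp

section \<open>Centralizers in positive order\<close>

context
  fixes A B :: 'r and r N :: nat and a :: "'k poly" and c :: 'k
  assumes A: "has_symbol r a A" "a \<noteq> 0" "0 < r"
    and B: "B \<in> ops (Suc N)"
    and AB: "A * B - B * A = M [:c:]" and c: "c \<noteq> 0"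
begin

text \<open>The exponents give both powers the order \<open>r * m\<close>. The symbol of [A, f] = 0
  is the differential equation in \<open>power_proportional\<close>, whose scalar makes the leading
  terms cancel.\<close>

lemma centralizer_reduce:
  assumes f: "A * f = f * A" "has_symbol m b f" "b \<noteq> 0"
  obtains l where "l \<noteq> 0" "f ^ r - M [:l:] * A ^ m \<in> ops (r * m)"
    "A * (f ^ r - M [:l:] * A ^ m) = (f ^ r - M [:l:] * A ^ m) * A"
proof -
  have "has_symbol (r + m - 1) (of_nat r * a * pderiv b - of_nat m * b * pderiv a) 0"
    using has_symbol_comm[OF A(1) f(2)] f(1) by simp
  then have "of_nat r * a * pderiv b = of_nat m * b * pderiv a"
    using has_symbol_0D by fastforce
  then obtain l where l: "l \<noteq> 0" "b ^ r = smult l (a ^ m)"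
    using power_proportional A f(3) by metis
  have "has_symbol (r * m) (b ^ r - smult l (a ^ m)) (f ^ r - M [:l:] * A ^ m)"
    using has_symbol_diff[OF has_symbol_power[OF f(2), of r, unfolded mult.commute[of m]]
        has_symbol_const_mult[OF has_symbol_power[OF A(1)]]] .
  then have "f ^ r - M [:l:] * A ^ m \<in> ops (r * m)"
    by (simp add: l has_symbol_zero_iff)
  moreover have "A * (f ^ r - M [:l:] * A ^ m) = (f ^ r - M [:l:] * A ^ m) * A"
  proof -
    have "A * (M [:l:] * A ^ m) = M [:l:] * A ^ m * A"
      using const_power_commute[OF has_symbol_ops[OF A(1)]] .
    then show ?thesis
      using commuting_power[OF f(1), of r] by (simp add: ring_distribs)
  qed
  ultimately show thesis using l that by blast
qed

lemma power_gen_comm: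
  "has_symbol (r * k) (of_nat (Suc k) * a ^ k * [:c:]) (A ^ Suc k * B - B * A ^ Suc k)"
  using has_symbol_power_comm[OF A(1), of 0 "[:c:]" B k] has_symbol_M[of "[:c:]"] by (simp add: AB)

lemma const_mult_comm: "M [:l:] * L * B - B * (M [:l:] * L) = M [:l:] * (L * B - B * L)"
  using const_comm[OF B, of l]
  by (simp add: ring_distribs mult.assoc[symmetric])

text \<open>On the centralizer of \<open>A\<close>, the derivation \<open>[\<cdot>, B]\<close> lowers the order by at least \<open>r\<close>: it raises
  the order by at most \<open>N\<close>, but if it lowered the order of \<open>f\<close> by less than \<open>r\<close>, then it would raise
  the order of \<open>f ^ r - l A ^ m\<close> by strictly more than that of \<open>f\<close>.\<close>

lemma comm_lowers_order:
  assumes "A * f = f * A" "has_symbol m b f" "b \<noteq> 0"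
    and "has_symbol s d (f * B - B * f)" "d \<noteq> 0"
  shows "s + r \<le> m"
  using assms
\<comment> \<open>The measure is the slack in the bound \<open>s \<le> m + N\<close>; it shrinks as
  the shift \<open>s - m\<close> grows.\<close>
proof (induction "m + N - s" arbitrary: f m b s d rule: less_induct)
  case less
  show ?case
  proof (rule ccontr)
    assume neg: "\<not> s + r \<le> m"
    obtain q where q: "r = Suc q" using A(3) by (auto simp: gr0_conv_Suc)
    have bound: "t \<le> k + N"
      if "h \<in> ops (Suc k)" "has_symbol t e (h * B - B * h)" "e \<noteq> 0" for h k t e
    proof -
      have "h * B - B * h \<in> ops (k + Suc N)"
        using ops_mult[OF that(1) B] ops_mult'[OF B that(1)] by (simp add: ops_diff add.commute)
      from has_symbol_in_ops[OF that(2,3) this] show ?thesis by simp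
    qed
    have s: "s \<le> m + N"
      using bound[OF has_symbol_ops[OF less.prems(2)] less.prems(4,5)] .
    obtain l where l: "l \<noteq> 0" and g: "f ^ r - M [:l:] * A ^ m \<in> ops (r * m)"
      "A * (f ^ r - M [:l:] * A ^ m) = (f ^ r - M [:l:] * A ^ m) * A"
      using centralizer_reduce[OF less.prems(1-3)] .
    define g where "g = f ^ r - M [:l:] * A ^ m"
    define s' where "s' = m * q + s"
    define d' where "d' = of_nat r * b ^ q * d"
    have d': "d' \<noteq> 0"
      using less.prems(3,5) A(3) by (simp add: d'_def)
    have f_r: "has_symbol s' d' (f ^ r * B - B * f ^ r)"
      using has_symbol_power_comm[OF less.prems(2,4), of q] unfolding q s'_def d'_def .
    \<comment> \<open>By \<open>neg\<close>, \<open>s'\<close> exceeds \<open>r * (m - 1)\<close>,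
      the order of [A ^ m, B] for \<open>m > 0\<close>. Hence the leading term of [g, B] comes from
      \<open>f ^ r\<close> alone.\<close>
    have A_m: "A ^ m * B - B * A ^ m \<in> ops s'"
    proof (cases m)
      case (Suc k)
      have "Suc (r * k) \<le> s'" using neg by (simp add: s'_def q Suc)
      then show ?thesis
        using has_symbol_ops[OF power_gen_comm[of k]] Suc ops_mono by blast
    qed simp
    have "g * B - B * g = (f ^ r * B - B * f ^ r) - M [:l:] * (A ^ m * B - B * A ^ m)"
      unfolding g_def const_mult_comm[symmetric] by (simp add: algebra_simps)
    moreover have "has_symbol s' 0 (M [:l:] * (A ^ m * B - B * A ^ m))"
      unfolding has_symbol_zero_iff using A_m by (rule ops_M)
    ultimately have dg: "has_symbol s' d' (g * B - B * g)"
      using has_symbol_diff[OF f_r] by fastforce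
    have "g \<noteq> 0"
      using dg d' has_symbol_0D by auto
    then obtain m' b' where m': "m' < r * m" "b' \<noteq> 0" "has_symbol m' b' g"
      using obtain_symbol g(1)[folded g_def] by blast
    have "s' \<le> m' + N"
      using bound[OF has_symbol_ops[OF m'(3)] dg d'] .
    moreover have "m' < m * q + m"
      using m'(1) by (simp add: q mult.commute)
    ultimately have "m' + N - s' < m + N - s"
      using s by (simp add: s'_def)
    \<comment> \<open>This yields \<open>s' + r \<le> m' < m * q + m\<close>, so
      \<open>s + r < m\<close>, contrary to \<open>neg\<close>.\<close>
    from less.hyps[OF this g(2)[folded g_def] m'(3,2) dg d']
    show False
      using neg \<open>m' < m * q + m\<close> by (simp add: s'_def)
  qed
qed

text \<open>In order 0, [A, f] = 0 makes the symbol constant. In order \<open>m > 0\<close>,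
  [f ^ r, B] = 0 leaves [g, B] = - l [A ^ m, B], of order exactly \<open>r * (m - 1)\<close>. By
  \<open>comm_lowers_order\<close>, \<open>g\<close> then has order at least \<open>r * m\<close>,
  more than \<open>centralizer_reduce\<close> allows.\<close>

lemma centralizer_kernel_const:
  assumes f: "A * f = f * A" "f * B = B * f" "f \<in> ops n"
  obtains e where "f = M [:e:]"
proof (cases "f = 0")
  case True
  then show thesis using that[of 0] by simp
next
  case False
  then obtain m b where m: "b \<noteq> 0" "has_symbol m b f"
    using obtain_symbol f(3) by metis
  show thesis
  proof (cases m)
    case 0
    have "has_symbol (r - 1) (of_nat r * a * pderiv b) 0"
      using has_symbol_comm[OF A(1) m(2)] f(1) 0 by simp
    then have "pderiv b = 0"
      using has_symbol_0D A by fastforce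
    then obtain e where "b = [:e:]"
      using pderiv_iszero by blast
    then show thesis using m(2) 0 that by (simp add: has_symbol_def)
  next
    case (Suc k)
    obtain l where l: "l \<noteq> 0" and g: "f ^ r - M [:l:] * A ^ m \<in> ops (r * m)"
      "A * (f ^ r - M [:l:] * A ^ m) = (f ^ r - M [:l:] * A ^ m) * A"
      using centralizer_reduce[OF f(1) m(2,1)] .
    define g where "g = f ^ r - M [:l:] * A ^ m"
    define d where "d = smult (- l) (of_nat (Suc k) * a ^ k * [:c:])"
    have d: "d \<noteq> 0"
      using A(2) c l by (simp add: d_def del: of_nat_Suc)
    have "g * B - B * g = (f ^ r * B - B * f ^ r) - M [:l:] * (A ^ m * B - B * A ^ m)"
      unfolding g_def const_mult_comm[symmetric] by (simp add: algebra_simps)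
    also have "\<dots> = M [:- l:] * (A ^ m * B - B * A ^ m)"
      using commuting_power[OF f(2)[symmetric], of r] M_minus[of "[:l:]"] by simp
    finally have dg: "has_symbol (r * k) d (g * B - B * g)"
      using has_symbol_const_mult[OF power_gen_comm[of k], of "- l"] by (simp only: d_def Suc)
    have "g \<noteq> 0"
      using dg d has_symbol_0D by auto
    then obtain m' b' where m': "m' < r * m" "b' \<noteq> 0" "has_symbol m' b' g"
      using obtain_symbol g(1)[folded g_def] by blast
    have "r * k + r \<le> m'"
      using comm_lowers_order[OF g(2)[folded g_def] m'(3,2) dg d] .
    then show thesis using m'(1) Suc by simp
  qed
qed

text \<open>Since [A ^ (i + 1), B] = (i + 1) c A ^ i, monomials are integrated by division. The last
  two conclusions are what \<open>centralizer_kernel_const\<close> asks of a difference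
  \<open>f - P\<close>.\<close>

lemma polys_antiderivative:
  assumes "L \<in> polys A"
  shows "\<exists>P \<in> polys A. P * B - B * P = L \<and> (\<exists>n. P \<in> ops n) \<and> A * P = P * A"
  using assms
proof induction
  case zero
  then show ?case by (auto intro!: bexI[of _ 0] polys.zero exI[of _ 0])
next
  case (add L d i)
  then obtain P n where P: "P \<in> polys A" "P * B - B * P = L" "P \<in> ops n" "A * P = P * A"
    by blast
  define e where "e = d / (of_nat (Suc i) * c)"
  define Q where "Q = P + M [:e:] * A ^ Suc i"
  have ops_A: "A ^ k \<in> ops (Suc (r * k))" for k
    using has_symbol_ops[OF has_symbol_power[OF A(1)]] .
  have pow: "A ^ Suc k * B - B * A ^ Suc k = M [:of_nat (Suc k) * c:] * A ^ k" for k
  proof (induction k)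
    case (Suc k)
    have "A ^ Suc (Suc k) * B - B * A ^ Suc (Suc k) =
        A * (A ^ Suc k * B - B * A ^ Suc k) + (A * B - B * A) * A ^ Suc k"
      by (simp add: algebra_simps)
    also have "\<dots> = A * M [:of_nat (Suc k) * c:] * A ^ k + M [:c:] * A ^ Suc k"
      by (simp only: Suc AB mult.assoc)
    also have "\<dots> = (M [:of_nat (Suc k) * c:] + M [:c:]) * A ^ Suc k"
      by (simp add: const_comm[OF has_symbol_ops[OF A(1)], symmetric] mult.assoc ring_distribs)
    also have "M [:of_nat (Suc k) * c:] + M [:c:] = M [:of_nat (Suc (Suc k)) * c:]"
      by (simp add: M_add[symmetric] algebra_simps)
    finally show ?case .
  qed (simp add: AB)
  have "Q * B - B * Q = L + M [:e:] * (A ^ Suc i * B - B * A ^ Suc i)"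
    unfolding Q_def P(2)[symmetric] const_mult_comm[symmetric] by (simp add: algebra_simps)
  also have "\<dots> = L + M [:d:] * A ^ i"
  proof -
    have "M [:e:] * M [:of_nat (Suc i) * c:] = M [:d:]"
      using c by (simp add: M_mult[symmetric] e_def del: of_nat_Suc)
    then show ?thesis by (simp only: pow mult.assoc[symmetric])
  qed
  finally have "Q * B - B * Q = L + M [:d:] * A ^ i" .
  moreover have "Q \<in> polys A"
    unfolding Q_def using P(1) by (rule polys.add)
  moreover have "Q \<in> ops (n + Suc (r * Suc i))"
    unfolding Q_def by (intro ops_add ops_M ops_mono[OF P(3)] ops_mono[OF ops_A]) auto
  moreover have "A * Q = Q * A"
  proof -
    have "A * (M [:e:] * A ^ Suc i) = M [:e:] * A ^ Suc i * A"
      using const_power_commute[OF has_symbol_ops[OF A(1)]] .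
    then show ?thesis using P(4) by (simp add: Q_def ring_distribs)
  qed
  ultimately show ?case by blast
qed

lemma centralizer_positive_order:
  assumes "A * f = f * A" "f \<in> ops n"
  shows "f \<in> polys A"
  using assms
proof (induction n arbitrary: f)
  case 0
  then show ?case by (simp add: polys.zero)
next
  case (Suc n)
  have "f * B - B * f \<in> ops n"
  proof (cases "f * B - B * f = 0")
    case False
    then have "f \<noteq> 0" by auto
    then obtain m b where m: "m < Suc n" "b \<noteq> 0" "has_symbol m b f"
      using obtain_symbol Suc.prems(2) by blast
    have "f * B - B * f \<in> ops (n + Suc N)"
      using ops_mult[OF Suc.prems(2) B] ops_mult'[OF B Suc.prems(2)] by (simp add: ops_diff add.commute)
    then obtain s d where s: "d \<noteq> 0" "has_symbol s d (f * B - B * f)"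
      using obtain_symbol False by metis
    have "s + r \<le> m"
      using comm_lowers_order[OF Suc.prems(1) m(3,2) s(2,1)] .
    then show ?thesis
      using m(1) A(3) ops_mono[OF has_symbol_ops[OF s(2)]] by simp
  qed simp
  then have "f * B - B * f \<in> polys A"
    using Suc.IH comm_in_centralizer[OF AB Suc.prems(2,1)] by blast
  then obtain P k where P: "P \<in> polys A" "P * B - B * P = f * B - B * f" "P \<in> ops k" "A * P = P * A"
    using polys_antiderivative by blast
  have "A * (f - P) = (f - P) * A"
    using Suc.prems(1) P(4) by (simp add: ring_distribs)
  moreover have "(f - P) * B = B * (f - P)"
    using P(2) by (simp add: algebra_simps)
  moreover have "f - P \<in> ops (Suc n + k)"
    by (intro ops_diff ops_mono[OF Suc.prems(2)] ops_mono[OF P(3)]) auto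
  ultimately obtain e where "f - P = M [:e:]"
    using centralizer_kernel_const by metis
  then have "f = P + M [:e:] * A ^ 0"
    by (simp add: algebra_simps)
  then show ?case
    using P(1) polys.add by metis
qed

end

section \<open>Centralizers in order zero\<close>

text \<open>Comparing symbols in [A, B] = c shows that \<open>pderiv p\<close> divides a nonzero
  constant, so \<open>p\<close> is affine. Then \<open>f\<close> has order 0 as well, and every
  polynomial in the variable is a polynomial in \<open>p\<close>.\<close>

lemma centralizer_order_0:
  assumes A: "A = M p" and B: "B \<in> ops k"
    and AB: "A * B - B * A = M [:c:]" and c: "c \<noteq> 0"
    and f: "A * f = f * A" "f \<in> ops n"
  shows "f \<in> polys A"
proof -
  have p': "pderiv p \<noteq> 0"
  proof
    assume "pderiv p = 0"
    then obtain e where "p = [:e:]" using pderiv_iszero by blast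
    then have "M [:c:] = 0" using AB const_comm[OF B, of e] A by simp
    then show False using M_eq_0 c by fastforce
  qed
  have symA: "has_symbol 0 p A" using A has_symbol_M by simp
  have "B \<noteq> 0"
    using AB M_eq_0 c by fastforce
  then obtain s \<beta> where s: "\<beta> \<noteq> 0" "has_symbol s \<beta> B"
    using obtain_symbol B by metis
  have comm: "has_symbol (s - 1) (- (of_nat s * \<beta> * pderiv p)) (M [:c:])"
    using has_symbol_comm[OF symA s(2)] AB by simp
  \<comment> \<open>Subtraction is truncated, so this leaves \<open>s\<close> as 0 or 1; the
    divisibility drawn below holds in both cases.\<close>
  have "s - 1 = 0"
  proof (rule ccontr)
    assume "s - 1 \<noteq> 0"
    then have "has_symbol (s - 1) 0 (M [:c:])"
      using ops_mono[OF has_symbol_ops[OF has_symbol_M[of "[:c:]"]], of "s - 1"]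
      by (simp add: has_symbol_zero_iff)
    from has_symbol_unique[OF this comm] show False
      using s(1) p' \<open>s - 1 \<noteq> 0\<close> by simp
  qed
  then have "[:c:] = - (of_nat s * \<beta> * pderiv p)"
    using comm has_symbol_M has_symbol_unique by metis
  then have "pderiv p dvd [:c:]"
    by (metis dvd_minus_iff dvd_triv_right)
  then have "degree (pderiv p) = 0"
    using c by (metis degree_pCons_0 dvd_imp_degree_le le_zero_eq pCons_eq_0_iff)
  then have "degree p = 1"
    using p' by (simp add: degree_pderiv pderiv_eq_0_iff)
  then obtain u v where p: "p = [:u, v:]" "v \<noteq> 0"
    by (metis degree1_coeffs One_nat_def)
  obtain b where b: "f = M b"
  proof (cases "f = 0")
    case False
    then obtain m b where m: "b \<noteq> 0" "has_symbol m b f"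
      using obtain_symbol f by metis
    have "has_symbol (m - 1) (- (of_nat m * b * pderiv p)) 0"
      using has_symbol_comm[OF symA m(2)] f(1) by simp
    then have "m = 0"
      using has_symbol_0D m(1) p' by fastforce
    then show thesis using m(2) that by (simp add: has_symbol_def)
  qed (use that[of 0] in simp)
  \<comment> \<open>This is \<open>b\<close> composed with the inverse of the affine map
    \<open>p\<close>.\<close>
  define q where "q = pcompose b [:- u / v, 1 / v:]"
  have "pcompose q p = b"
    using p by (simp add: q_def pcompose_assoc[symmetric] pcompose_pCons pcompose_idR)
  then show ?thesis
    using M_pcompose_in_polys[of q p] A b by simp
qed

theorem centralizer_eq_polys:
  assumes A: "A \<in> ops i" and B: "B \<in> ops k"
    and AB: "A * B - B * A = M [:c:]" and c: "c \<noteq> 0"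
    and f: "A * f = f * A" "f \<in> ops n"
  shows "f \<in> polys A"
proof -
  have "A \<noteq> 0"
    using AB M_eq_0 c by fastforce
  then obtain r a where r: "a \<noteq> 0" "has_symbol r a A"
    using obtain_symbol A by metis
  show ?thesis
  proof (cases "r = 0")
    case True
    then have "A = M a" using r(2) by (simp add: has_symbol_def)
    then show ?thesis using centralizer_order_0 assms by blast
  next
    case False
    then show ?thesis
      using centralizer_positive_order[OF r(2,1) _ ops_mono[OF B, of "Suc k"] AB c f] by simp
  qed
qed

end

section \<open>The Weyl algebra as an algebra of operators\<close>

lemma Suc_times_choose_Suc: "Suc t * (k choose Suc t) = (k - t) * (k choose t)"
  by (cases "t \<le> k") (use binomial_absorb_comp[of k t] binomial_absorption[of t k] in \<open>simp_all add: binomial_eq_0\<close>)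

context weyl_operators
begin

text \<open>The Leibniz rule with all its terms: \<open>t\<close> of the \<open>j\<close>
  derivatives fall on the monomial and contribute \<open>(k choose t) * fact t\<close>, matching
  \<open>weyl_mult\<close>.\<close>

lemma D_power_monom:
  "D ^ j * M (monom d k) =
    (\<Sum>t\<le>j. M (monom (d * of_nat ((j choose t) * (k choose t) * fact t)) (k - t)) * D ^ (j - t))"
proof (induction j)
  case 0
  then show ?case by simp
next
  case (Suc j)
  define T where "T e t = M (monom (d * of_nat e) (k - t)) * D ^ (Suc j - t)" for e t
  have T_add: "T (e + e') t = T e t + T e' t" for e e' t
    by (simp add: T_def ring_distribs M_add add_monom[symmetric])
  have T_0: "T 0 t = 0" for t
    by (simp add: T_def)
  have step: "D * (M (monom (d * of_nat e) (k - t)) * D ^ (j - t)) = T e t + T (e * (k - t)) (Suc t)"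
    if "t \<le> j" for e t
  proof -
    have "D * (M (monom (d * of_nat e) (k - t)) * D ^ (j - t)) =
        (D * M (monom (d * of_nat e) (k - t))) * D ^ (j - t)"
      by (simp add: mult.assoc)
    also have "\<dots> = M (monom (d * of_nat e) (k - t)) * D ^ Suc (j - t)
        + M (pderiv (monom (d * of_nat e) (k - t))) * D ^ (j - t)"
      by (simp add: D_M ring_distribs mult.assoc)
    finally show ?thesis
      using that by (simp add: T_def Suc_diff_le pderiv_monom ac_simps)
  qed
  \<comment> \<open>Index \<open>t + 1\<close> receives the old term \<open>t + 1\<close> with
    \<open>D\<close> moved to the right, and the old term \<open>t\<close> with its monomial
    differentiated; Pascal's rule combines them.\<close>
  have coeff: "(Suc j choose Suc t) * (k choose Suc t) * fact (Suc t) =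
      (j choose Suc t) * (k choose Suc t) * fact (Suc t) + (j choose t) * (k choose t) * fact t * (k - t)" for t
  proof -
    have "(j choose t) * (k choose Suc t) * fact (Suc t) = (j choose t) * (Suc t * (k choose Suc t)) * fact t"
      by (simp add: algebra_simps)
    also have "\<dots> = (j choose t) * (k choose t) * fact t * (k - t)"
      unfolding Suc_times_choose_Suc by simp
    finally show ?thesis by (simp add: ring_distribs del: fact_Suc)
  qed
  have "D ^ Suc j * M (monom d k) = D * (D ^ j * M (monom d k))"
    by (simp add: mult.assoc)
  also have "\<dots> = (\<Sum>t\<le>j. T ((j choose t) * (k choose t) * fact t) t
      + T ((j choose t) * (k choose t) * fact t * (k - t)) (Suc t))"
    unfolding Suc.IH sum_distrib_left by (intro sum.cong refl step) auto
  also have "\<dots> = (\<Sum>t\<le>Suc j. T ((j choose t) * (k choose t) * fact t) t)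
      + (\<Sum>t\<le>j. T ((j choose t) * (k choose t) * fact t * (k - t)) (Suc t))"
    by (simp add: sum.distrib binomial_eq_0 T_0)
  also have "\<dots> = T ((Suc j choose 0) * (k choose 0) * fact 0) 0
      + (\<Sum>t\<le>j. T ((Suc j choose Suc t) * (k choose Suc t) * fact (Suc t)) (Suc t))"
    by (subst sum.atMost_Suc_shift) (simp only: coeff T_add sum.distrib add.assoc binomial_n_0)
  also have "\<dots> = (\<Sum>t\<le>Suc j. T ((Suc j choose t) * (k choose t) * fact t) t)"
    by (subst sum.atMost_Suc_shift) (rule refl)
  finally show ?case unfolding T_def .
qed

lemma monom_term_mult:
  "(M (monom c i) * D ^ j) * (M (monom d k) * D ^ l) =
    (\<Sum>t\<le>min j k. M (monom (c * d * of_nat ((j choose t) * (k choose t) * fact t)) (i + k - t)) * D ^ (j + l - t))"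
proof -
  have "(M (monom c i) * D ^ j) * (M (monom d k) * D ^ l) = M (monom c i) * (D ^ j * M (monom d k)) * D ^ l"
    by (simp add: mult.assoc)
  also have "\<dots> = (\<Sum>t\<le>j. M (monom c i * monom (d * of_nat ((j choose t) * (k choose t) * fact t)) (k - t)) * D ^ (j - t + l))"
    unfolding D_power_monom by (simp only: sum_distrib_left sum_distrib_right M_mult mult.assoc power_add)
  \<comment> \<open>Terms with \<open>k < t\<close> vanish. Up to the cut, \<open>k - t\<close> and
    \<open>j - t\<close> are genuine differences, so the exponents can be regrouped.\<close>
  also have "\<dots> = (\<Sum>t\<le>min j k. M (monom c i * monom (d * of_nat ((j choose t) * (k choose t) * fact t)) (k - t)) * D ^ (j - t + l))"
  proof (rule sum.mono_neutral_right)
    show "\<forall>t \<in> {..j} - {..min j k}. M (monom c i *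
        monom (d * of_nat ((j choose t) * (k choose t) * fact t)) (k - t)) * D ^ (j - t + l) = 0"
    proof
      fix t assume "t \<in> {..j} - {..min j k}"
      then have "k < t" by auto
      then show "M (monom c i *
        monom (d * of_nat ((j choose t) * (k choose t) * fact t)) (k - t)) * D ^ (j - t + l) = 0"
        by (simp add: binomial_eq_0)
    qed
  qed auto
  also have "\<dots> = (\<Sum>t\<le>min j k. M (monom (c * d * of_nat ((j choose t) * (k choose t) * fact t)) (i + k - t)) * D ^ (j + l - t))"
    by (intro sum.cong refl) (simp add: mult_monom mult.assoc)
  finally show ?thesis .
qed

text \<open>The action of the Weyl algebra in which X multiplies by the variable and Y acts as
  \<open>D\<close>; it moves calculations into an associative ring.\<close>

definition rep :: "'k weyl \<Rightarrow> 'r" where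
  "rep P = (\<Sum>(i, j)\<in>Poly_Mapping.keys P. M (monom (Poly_Mapping.lookup P (i, j)) i) * D ^ j)"

lemma rep_superset:
  assumes "finite S" "Poly_Mapping.keys P \<subseteq> S"
  shows "rep P = (\<Sum>(i, j)\<in>S. M (monom (Poly_Mapping.lookup P (i, j)) i) * D ^ j)"
  unfolding rep_def using assms
  by (intro sum.mono_neutral_left) (auto simp: in_keys_iff)

lemma rep_add: "rep (P + Q) = rep P + rep Q"
proof -
  let ?S = "Poly_Mapping.keys P \<union> Poly_Mapping.keys Q"
  have "rep (P + Q) = (\<Sum>(i, j)\<in>?S. M (monom (Poly_Mapping.lookup (P + Q) (i, j)) i) * D ^ j)"
    using keys_add[of P Q] by (intro rep_superset) auto
  also have "\<dots> = (\<Sum>(i, j)\<in>?S. M (monom (Poly_Mapping.lookup P (i, j)) i) * D ^ j)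
      + (\<Sum>(i, j)\<in>?S. M (monom (Poly_Mapping.lookup Q (i, j)) i) * D ^ j)"
    by (simp add: lookup_add add_monom[symmetric] M_add ring_distribs split_beta sum.distrib)
  also have "\<dots> = rep P + rep Q"
    by (simp add: rep_superset[of ?S])
  finally show ?thesis .
qed

lemma rep_0 [simp]: "rep 0 = 0"
  by (simp add: rep_def)

lemma rep_diff: "rep (P - Q) = rep P - rep Q"
  using rep_add[of "P - Q" Q] by (simp add: algebra_simps)

lemma rep_sum: "rep (sum f I) = (\<Sum>i\<in>I. rep (f i))"
  by (induction I rule: infinite_finite_induct) (auto simp: rep_add)

lemma rep_single: "rep (Poly_Mapping.single (i, j) c) = M (monom c i) * D ^ j"
  by (simp add: rep_def)

lemma rep_const: "rep (weyl_const c) = M [:c:]"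
  by (simp add: weyl_const_def rep_single monom_0)

lemma rep_mult: "rep (weyl_mult P Q) = rep P * rep Q"
  unfolding weyl_mult_def rep_sum
  by (simp add: rep_sum rep_single split_beta rep_def[of P] rep_def[of Q]
      sum_distrib_left sum_distrib_right monom_term_mult)
    (rule sum.swap)

lemma rep_eq_sum:
  assumes "\<forall>(i, j) \<in> Poly_Mapping.keys P. i < m \<and> j < n"
  shows "rep P = (\<Sum>j<n. M (\<Sum>i<m. monom (Poly_Mapping.lookup P (i, j)) i) * D ^ j)"
proof -
  have "rep P = (\<Sum>(i, j)\<in>{..<m} \<times> {..<n}. M (monom (Poly_Mapping.lookup P (i, j)) i) * D ^ j)"
    using assms by (intro rep_superset) auto
  also have "\<dots> = (\<Sum>j<n. \<Sum>i<m. M (monom (Poly_Mapping.lookup P (i, j)) i) * D ^ j)"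
    unfolding sum.cartesian_product[symmetric] by (rule sum.swap)
  finally show ?thesis
    by (simp add: M_sum sum_distrib_right)
qed

lemma keys_bounded:
  fixes P :: "'k weyl"
  obtains m n where "\<forall>(i, j) \<in> Poly_Mapping.keys P. i < m \<and> j < n"
proof -
  have "finite (fst ` Poly_Mapping.keys P)" "finite (snd ` Poly_Mapping.keys P)"
    by auto
  then obtain m n where "fst ` Poly_Mapping.keys P \<subseteq> {..<m}" "snd ` Poly_Mapping.keys P \<subseteq> {..<n}"
    by (meson finite_nat_iff_bounded)
  then show thesis by (intro that[of m n]) force
qed

lemma rep_ops: "\<exists>n. rep P \<in> ops n"
proof -
  obtain m n where b: "\<forall>(i, j) \<in> Poly_Mapping.keys P. i < m \<and> j < n"
    using keys_bounded[of P] .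
  have "rep P \<in> ops n"
    unfolding rep_eq_sum[OF b] by (rule opsI)
  then show ?thesis ..
qed

text \<open>Independence of the powers of \<open>D\<close> makes the polynomial in front of each
  power vanish, hence every entry of \<open>P\<close>: the action is faithful.\<close>

lemma rep_eq_0D:
  assumes "rep P = 0"
  shows "P = 0"
proof (rule poly_mapping_eqI)
  fix ij :: "nat \<times> nat"
  obtain m n where b: "\<forall>(i, j) \<in> Poly_Mapping.keys P. i < m \<and> j < n"
    using keys_bounded[of P] .
  obtain i j where ij: "ij = (i, j)" by fastforce
  show "Poly_Mapping.lookup P ij = Poly_Mapping.lookup 0 ij"
  proof (cases "(i, j) \<in> Poly_Mapping.keys P")
    case True
    then have *: "i < m" "j < n" using b by auto
    have "(\<Sum>i<m. monom (Poly_Mapping.lookup P (i, j)) i) = 0"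
      by (rule ops_coeffs_0[OF _ *(2)]) (use rep_eq_sum[OF b] assms in simp)
    then have "coeff (\<Sum>i<m. monom (Poly_Mapping.lookup P (i, j)) i) i = 0"
      by simp
    then show ?thesis using *(1) by (simp add: coeff_sum ij)
  qed (simp add: ij in_keys_iff)
qed

lemma rep_inj: "rep P = rep Q \<Longrightarrow> P = Q"
  using rep_eq_0D[of "P - Q"] by (simp add: rep_diff)

lemma polys_rep:
  assumes "L \<in> polys (rep A)"
  shows "\<exists>P \<in> weyl_gen_subalg A. rep P = L"
  using assms
proof induction
  case zero
  then show ?case using weyl_gen_subalg.const[of 0 A] by (force simp: rep_const)
next
  case (add L c i)
  then obtain P where P: "P \<in> weyl_gen_subalg A" "rep P = L" by blast
  have "\<exists>Q \<in> weyl_gen_subalg A. rep Q = rep A ^ i"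
  proof (induction i)
    case 0
    then show ?case using weyl_gen_subalg.const[of 1 A] M_one
      by (force simp: rep_const one_pCons)
  next
    case (Suc i)
    then show ?case using weyl_gen_subalg.mult[OF weyl_gen_subalg.gen] rep_mult
      by (metis power_Suc)
  qed
  then obtain Q where Q: "Q \<in> weyl_gen_subalg A" "rep Q = rep A ^ i" by blast
  have "P + weyl_mult (weyl_const c) Q \<in> weyl_gen_subalg A"
    by (intro weyl_gen_subalg.intros P Q)
  moreover have "rep (P + weyl_mult (weyl_const c) Q) = L + M [:c:] * rep A ^ i"
    by (simp add: rep_add rep_mult rep_const P Q)
  ultimately show ?case by blast
qed

theorem centralizer_in_gen_subalg:
  fixes A B w :: "'k weyl"
  assumes AB: "weyl_comm A B = weyl_const c" "c \<noteq> 0" and w: "weyl_comm A w = 0"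
  shows "w \<in> weyl_gen_subalg A"
proof -
  have "rep A * rep B - rep B * rep A = M [:c:]"
    using arg_cong[OF AB(1), of rep] by (simp add: weyl_comm_def rep_diff rep_mult rep_const)
  moreover have "rep A * rep w = rep w * rep A"
    using arg_cong[OF w, of rep] by (simp add: weyl_comm_def rep_diff rep_mult)
  moreover obtain i k n where "rep A \<in> ops i" "rep B \<in> ops k" "rep w \<in> ops n"
    using rep_ops by blast
  ultimately have "rep w \<in> polys (rep A)"
    using centralizer_eq_polys AB(2) by blast
  then show ?thesis using polys_rep rep_inj by blast
qed

end

section \<open>The ring of additive endomorphisms of K[X]\<close>

text \<open>Additivity gives the law f (g + h) = f g + f h. A separate type lets the multiplication
  of \<open>ring_1\<close> be composition.\<close>

typedef (overloaded) 'k poly_endo = "{f :: 'k::field_char_0 poly \<Rightarrow> 'k poly. \<forall>p q. f (p + q) = f p + f q}"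
  by (rule exI[of _ id]) simp

setup_lifting type_definition_poly_endo
lifting_forget poly.lifting

instantiation poly_endo :: (field_char_0) ring_1
begin

lift_definition zero_poly_endo :: "'a poly_endo" is "\<lambda>_. 0" by simp
lift_definition one_poly_endo :: "'a poly_endo" is "\<lambda>p. p" by simp
lift_definition plus_poly_endo :: "'a poly_endo \<Rightarrow> 'a poly_endo \<Rightarrow> 'a poly_endo"
  is "\<lambda>f g p. f p + g p" by (simp add: algebra_simps)
lift_definition minus_poly_endo :: "'a poly_endo \<Rightarrow> 'a poly_endo \<Rightarrow> 'a poly_endo"
  is "\<lambda>f g p. f p - g p" by (simp add: algebra_simps)
lift_definition uminus_poly_endo :: "'a poly_endo \<Rightarrow> 'a poly_endo"
  is "\<lambda>f p. - f p" by (simp add: algebra_simps)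
lift_definition times_poly_endo :: "'a poly_endo \<Rightarrow> 'a poly_endo \<Rightarrow> 'a poly_endo"
  is "\<lambda>f g p. f (g p)" by simp

instance
proof
  fix f g h :: "'a poly_endo"
  show "f + g + h = f + (g + h)" by transfer (simp add: add.assoc)
  show "f + g = g + f" by transfer (simp add: add.commute)
  show "0 + f = f" by transfer simp
  show "- f + f = 0" by transfer simp
  show "f - g = f + - g" by transfer simp
  show "f * g * h = f * (g * h)" by transfer simp
  show "1 * f = f" by transfer simp
  show "f * 1 = f" by transfer simp
  show "(f + g) * h = f * h + g * h" by transfer simp
  show "f * (g + h) = f * g + f * h" by transfer simp
  show "(0 :: 'a poly_endo) \<noteq> 1" by transfer (metis zero_neq_one)
qed

end

lift_definition mult_endo :: "'k::field_char_0 poly \<Rightarrow> 'k poly_endo" is "\<lambda>p q. p * q"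
  by (simp add: algebra_simps)

lift_definition pderiv_endo :: "'k::field_char_0 poly_endo" is pderiv
  by (simp add: pderiv_add)

interpretation poly_endo: weyl_operators mult_endo pderiv_endo
proof
  fix p q :: "'a poly"
  show "mult_endo (p + q) = mult_endo p + mult_endo q"
    by transfer (simp add: fun_eq_iff algebra_simps)
  show "mult_endo (p * q) = mult_endo p * mult_endo q"
    by transfer (simp add: fun_eq_iff algebra_simps)
  show "mult_endo (1 :: 'a poly) = 1"
    by transfer (simp add: fun_eq_iff)
  \<comment> \<open>A multiplication operator is recovered from its value at 1.\<close>
  show "p = 0" if "mult_endo p = 0"
    using that by transfer (auto dest: fun_cong[of _ _ 1])
  show "pderiv_endo * mult_endo p = mult_endo p * pderiv_endo + mult_endo (pderiv p)"
    by transfer (simp add: fun_eq_iff pderiv_mult mult.commute)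
qed

section \<open>Passage to the field of fractions\<close>

hide_const (open) Rat.Fract

instance fract :: ("{idom, ring_char_0}") field_char_0
proof
  show "inj (of_nat :: nat \<Rightarrow> 'a fract)"
    by (rule injI) (simp add: of_nat_fract eq_fract)
qed

lemma lookup_weyl_to_frac: "Poly_Mapping.lookup (weyl_to_frac P) ij = Fract (Poly_Mapping.lookup P ij) 1"
  unfolding weyl_to_frac_def by (simp add: Poly_Mapping.map.rep_eq when_def Zero_fract_def)

text \<open>The embedding into fractions is injective, so no coefficient is lost and the sums in
  \<open>weyl_mult\<close> keep their index sets.\<close>

lemma keys_weyl_to_frac: "Poly_Mapping.keys (weyl_to_frac P) = Poly_Mapping.keys P"
  by (auto simp: in_keys_iff lookup_weyl_to_frac Zero_fract_def eq_fract)

lemma weyl_to_frac_add: "weyl_to_frac (P + Q) = weyl_to_frac P + weyl_to_frac Q"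
  by (rule poly_mapping_eqI) (simp add: lookup_weyl_to_frac lookup_add)

lemma weyl_to_frac_diff: "weyl_to_frac (P - Q) = weyl_to_frac P - weyl_to_frac Q"
  by (rule poly_mapping_eqI) (simp add: lookup_weyl_to_frac lookup_minus)

lemma weyl_to_frac_0: "weyl_to_frac 0 = 0"
  by (rule poly_mapping_eqI) (simp add: lookup_weyl_to_frac Zero_fract_def)

lemma weyl_to_frac_sum: "weyl_to_frac (sum f I) = (\<Sum>i\<in>I. weyl_to_frac (f i))"
  by (induction I rule: infinite_finite_induct) (auto simp: weyl_to_frac_add weyl_to_frac_0)

lemma weyl_to_frac_single: "weyl_to_frac (Poly_Mapping.single ij c) = Poly_Mapping.single ij (Fract c 1)"
  by (rule poly_mapping_eqI) (simp add: lookup_weyl_to_frac lookup_single when_def Zero_fract_def)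

lemma weyl_to_frac_mult: "weyl_to_frac (weyl_mult P Q) = weyl_mult (weyl_to_frac P) (weyl_to_frac Q)"
  unfolding weyl_mult_def keys_weyl_to_frac weyl_to_frac_sum split_beta lookup_weyl_to_frac
    weyl_to_frac_single of_nat_fract mult_fract
  by simp

lemma weyl_to_frac_comm: "weyl_to_frac (weyl_comm P Q) = weyl_comm (weyl_to_frac P) (weyl_to_frac Q)"
  by (simp add: weyl_comm_def weyl_to_frac_diff weyl_to_frac_mult)

theorem theorem4p3:
  fixes A B w :: "'a::{idom, ring_char_0} weyl"
  assumes "\<exists>c. c dvd 1 \<and> weyl_comm A B = weyl_const c"
    and "weyl_comm A w = 0"
  shows "weyl_to_frac w \<in> weyl_gen_subalg (weyl_to_frac A)"
proof -
  obtain c where c: "c dvd 1" "weyl_comm A B = weyl_const c"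
    using assms(1) by blast
  have "weyl_comm (weyl_to_frac A) (weyl_to_frac B) = weyl_const (Fract c 1)"
    unfolding weyl_to_frac_comm[symmetric] c(2) weyl_const_def weyl_to_frac_single ..
  moreover have "Fract c 1 \<noteq> 0"
    using c(1) by (auto simp: Zero_fract_def eq_fract)
  moreover have "weyl_comm (weyl_to_frac A) (weyl_to_frac w) = 0"
    unfolding weyl_to_frac_comm[symmetric] assms(2) weyl_to_frac_0 ..
  ultimately show ?thesis
    by (rule poly_endo.centralizer_in_gen_subalg)
qed

end
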